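(* Let $PQ$ be a chord of a circle in the Euclidean plane, and let $M$ be the midpoint of $PQ$. Let $AB$ and $CD$ be two other chords of the circle, both passing through $M$. Assume that $A$ and $D$ do not belong to a same half-plane defined by the line $PQ$. Let $X$ be the intersection of $AD$ and $PQ$, and let $Y$ be the intersection of $BC$ and $PQ$. Then $M$ is also the midpoint of $XY$.
   Context: A chord of a circle is a segment joining two distinct points of the circle, so $P,Q,A,B,C,D$ lie on the circle; the chords $PQ$, $AB$, $CD$ are pairwise distinct chords through $M$. The half-planes defined by $PQ$ are the two half-planes bounded by the line through $P$ and $Q$; the assumption on $A$ and $D$ means that they lie on opposite sides of this line. The midpoint of $XY$ is the point $\frac{1}{2}(X+Y)$; in the degenerate case $X=Y$ it is that common point. *)

theory Defs
  imports "HOL-Analysis.Analysis"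
begin

definition is_chord :: "real ^ 2 \<Rightarrow> real \<Rightarrow> real ^ 2 \<Rightarrow> real ^ 2 \<Rightarrow> bool" where
  "is_chord Z r A B \<longleftrightarrow> A \<in> sphere Z r \<and> B \<in> sphere Z r \<and> A \<noteq> B"

abbreviation line_through :: "real ^ 2 \<Rightarrow> real ^ 2 \<Rightarrow> (real ^ 2) set" where
  "line_through A B \<equiv> affine hull {A, B}"

(* Half-planes are closed, so two points share no half-plane of L exactly when they lie
   strictly on opposite sides of L. Replacing (a, b) by (- a, - b) gives the other half-plane. *)
definition half_plane_of :: "(real ^ 2) set \<Rightarrow> (real ^ 2) set \<Rightarrow> bool" where
  "half_plane_of L H \<longleftrightarrow>
     (\<exists>a b. a \<noteq> 0 \<and> L = {x. a \<bullet> x = b} \<and> H = {x. a \<bullet> x \<le> b})"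

end

theory Submission imports Defs begin

text \<open>
  Take \<open>M\<close> as origin and write \<open>u, a, b, c, d, z\<close> for \<open>P, A, B, C, D\<close> and the centre \<open>Z\<close>.
  The circle is \<open>v \<bullet> v - 2 * (v \<bullet> z) = p\<close>, where \<open>p = u \<bullet> u\<close> because \<open>Q = - u\<close> and \<open>u\<close> is orthogonal
  to \<open>z\<close>. By the power of the point \<open>M\<close>, the second ends of the chords are \<open>b = - \<beta> a\<close> and
  \<open>c = - \<gamma> d\<close> with \<open>1 / \<beta> = (a \<bullet> a) / p\<close> and \<open>1 / \<gamma> = (d \<bullet> d) / p\<close>
  (\<open>opposite_end_of_chord\<close>).

  The points \<open>X = (1 - t) a + t d = x u\<close> and \<open>Y = - ((1 - s) \<beta> a + s \<gamma> d) = y u\<close> give two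
  combinations of \<open>a\<close> and \<open>d\<close> on the line \<open>PQ\<close>. As \<open>a\<close> is off this line, such combinations are all
  proportional, so \<open>((1 - s) \<beta>, s \<gamma>) = \<mu> (1 - t, t)\<close> and \<open>y = - \<mu> x\<close>. To see that \<open>\<mu> = 1\<close>,
  combine the circle equations of \<open>a\<close> and \<open>d\<close> with the weights \<open>1 - t\<close> and \<open>t\<close>: their linear
  parts add up to \<open>x u \<bullet> z = 0\<close>, which leaves \<open>(1 - t) (a \<bullet> a) + t (d \<bullet> d) = p\<close>, that is,
  \<open>(1 - t) / \<beta> + t / \<gamma> = 1\<close>. But \<open>\<mu>\<close> times the left side is \<open>(1 - s) + s = 1\<close>
  (\<open>butterfly_about_origin\<close>).
\<close>

lemma sphere_eq_inner:
  fixes v z :: "'a::real_inner"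
  assumes "norm (v - z) = r"
  shows "v \<bullet> v - 2 * (v \<bullet> z) = r\<^sup>2 - z \<bullet> z"
  unfolding assms[symmetric] power2_norm_eq_inner
  by (simp add: inner_diff inner_commute)

text \<open>
  The equation \<open>v \<bullet> v - 2 * (v \<bullet> z) = p\<close> with \<open>p > 0\<close> describes a sphere that has the origin
  inside and on which the product of the two distances along any chord through the origin is \<open>p\<close>.
\<close>

lemma opposite_end_of_chord:
  fixes a b z :: "'a::real_inner"
  assumes a: "a \<bullet> a - 2 * (a \<bullet> z) = p" and b: "b \<bullet> b - 2 * (b \<bullet> z) = p"
    and "p > 0" and "0 \<in> closed_segment a b"
  obtains \<beta> where "\<beta> > 0" and "b = - \<beta> *\<^sub>R a" and "\<beta> * (a \<bullet> a) = p"
proof -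
  obtain v where v: "0 \<le> v" "v \<le> 1" and comb: "0 = (1 - v) *\<^sub>R a + v *\<^sub>R b"
    using assms(4) by (auto simp: closed_segment_def)
  have "a \<noteq> 0" using a \<open>p > 0\<close> by auto
  have "v \<noteq> 0" using comb \<open>a \<noteq> 0\<close> by auto
  define \<beta> where "\<beta> = (1 - v) / v"
  have "\<beta> \<ge> 0" using v by (simp add: \<beta>_def)
  have "v *\<^sub>R b = - (1 - v) *\<^sub>R a"
    using comb by (simp add: algebra_simps)
  then have "(1 / v) *\<^sub>R (v *\<^sub>R b) = (1 / v) *\<^sub>R (- (1 - v) *\<^sub>R a)"
    by simp
  then have "b = (1 / v * - (1 - v)) *\<^sub>R a"
    using \<open>v \<noteq> 0\<close> by simp
  moreover have "1 / v * - (1 - v) = - \<beta>"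
    by (simp add: \<beta>_def diff_divide_distrib)
  ultimately have b_eq: "b = - \<beta> *\<^sub>R a"
    by simp
  \<comment> \<open>Both ends satisfy the equation; eliminating \<open>a \<bullet> z\<close> leaves a multiple of \<open>1 + \<beta>\<close>.\<close>
  have az: "a \<bullet> a - p = 2 * (a \<bullet> z)"
    using a by simp
  have "\<beta> * \<beta> * (a \<bullet> a) + \<beta> * (a \<bullet> a - p) = p"
    unfolding az using b by (simp add: b_eq mult.assoc mult.left_commute)
  then have "(1 + \<beta>) * (\<beta> * (a \<bullet> a) - p) = 0"
    by (simp add: algebra_simps)
  then have pow: "\<beta> * (a \<bullet> a) = p"
    using \<open>\<beta> \<ge> 0\<close> by auto
  then have "\<beta> > 0"
    using \<open>\<beta> \<ge> 0\<close> \<open>p > 0\<close> by (cases "\<beta> = 0") auto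
  then show thesis using b_eq pow that by blast
qed

text \<open>
  The hypotheses on \<open>\<beta>\<close> and \<open>\<gamma>\<close> make \<open>- \<beta> a\<close> and \<open>- \<gamma> d\<close> the other ends of the chords through the
  origin from \<open>a\<close> and \<open>d\<close>; \<open>u \<bullet> z = 0\<close> makes the origin the midpoint of the chord along \<open>u\<close>, and is
  what removes the linear parts when the two circle equations are added with weights \<open>1 - t\<close> and \<open>t\<close>.
\<close>

lemma butterfly_about_origin:
  fixes a d u z :: "'a::real_inner"
  assumes a: "a \<bullet> a - 2 * (a \<bullet> z) = p" and d: "d \<bullet> d - 2 * (d \<bullet> z) = p"
    and "u \<bullet> z = 0" and "p \<noteq> 0"
    and \<beta>: "\<beta> * (a \<bullet> a) = p" and \<gamma>: "\<gamma> * (d \<bullet> d) = p"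
    and X: "(1 - t) *\<^sub>R a + t *\<^sub>R d = x *\<^sub>R u"
    and Y: "(1 - s) *\<^sub>R (- \<beta> *\<^sub>R a) + s *\<^sub>R (- \<gamma> *\<^sub>R d) = y *\<^sub>R u"
    and "u \<noteq> 0" and off: "a \<notin> range (\<lambda>k. k *\<^sub>R u)"
  shows "x + y = 0"
proof -
  have u0: "k = 0" if "k *\<^sub>R a = l *\<^sub>R u" for k l
  proof (rule ccontr)
    assume "k \<noteq> 0"
    then have "a = (1 / k) *\<^sub>R (k *\<^sub>R a)" by simp
    also have "\<dots> = (l / k) *\<^sub>R u" using that by simp
    finally show False using off by blast
  qed
  have "t \<noteq> 0"
    using u0[of 1 x] X by auto
  define \<mu> where "\<mu> = s * \<gamma> / t"
  have st: "s * \<gamma> = \<mu> * t" using \<open>t \<noteq> 0\<close> by (simp add: \<mu>_def)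
  \<comment> \<open>Adding \<open>\<mu>\<close> times the relation for \<open>X\<close> to the one for \<open>Y\<close> cancels \<open>d\<close>, and \<open>a\<close> is off the
     line of \<open>u\<close>.\<close>
  have "(\<mu> * (1 - t) - (1 - s) * \<beta>) *\<^sub>R a
      = \<mu> *\<^sub>R ((1 - t) *\<^sub>R a + t *\<^sub>R d) + ((1 - s) *\<^sub>R (- \<beta> *\<^sub>R a) + s *\<^sub>R (- \<gamma> *\<^sub>R d))"
    using st by (simp add: algebra_simps)
  also have "\<dots> = (\<mu> * x + y) *\<^sub>R u"
    unfolding X Y by (simp add: algebra_simps)
  finally have rel: "(\<mu> * (1 - t) - (1 - s) * \<beta>) *\<^sub>R a = (\<mu> * x + y) *\<^sub>R u" .
  have at: "(1 - s) * \<beta> = \<mu> * (1 - t)"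
    using u0[OF rel] by simp
  have "(1 - t) * (a \<bullet> z) + t * (d \<bullet> z) = ((1 - t) *\<^sub>R a + t *\<^sub>R d) \<bullet> z"
    by (simp add: inner_add_left)
  also have "\<dots> = 0"
    unfolding X using \<open>u \<bullet> z = 0\<close> by simp
  finally have "(1 - t) * (a \<bullet> a) + t * (d \<bullet> d) = p"
    using a d by algebra
  then have "\<mu> * p = \<mu> * ((1 - t) * (a \<bullet> a) + t * (d \<bullet> d))"
    by simp
  also have "\<dots> = (\<mu> * (1 - t)) * (a \<bullet> a) + (\<mu> * t) * (d \<bullet> d)"
    by (simp only: distrib_left mult.assoc)
  also have "\<dots> = (1 - s) * (\<beta> * (a \<bullet> a)) + s * (\<gamma> * (d \<bullet> d))"
    by (simp only: st[symmetric] at[symmetric] mult.assoc)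
  also have "\<dots> = p"
    unfolding \<beta> \<gamma> by (simp add: algebra_simps)
  finally have "\<mu> = 1"
    using \<open>p \<noteq> 0\<close> by simp
  then have "(x + y) *\<^sub>R u = 0"
    using rel at by simp
  then show ?thesis using \<open>u \<noteq> 0\<close> by simp
qed

theorem mainTheorem1:
  fixes Z P Q A B C D M X Y :: "real ^ 2" and r :: real
  assumes "r > 0"
    and "is_chord Z r P Q" and "is_chord Z r A B" and "is_chord Z r C D"
    and "closed_segment A B \<noteq> closed_segment P Q"
    and "closed_segment C D \<noteq> closed_segment P Q"
    and "closed_segment A B \<noteq> closed_segment C D"
    and "M = midpoint P Q"
    and "M \<in> closed_segment A B" and "M \<in> closed_segment C D"
    and "\<not> (\<exists>H. half_plane_of (line_through P Q) H \<and> A \<in> H \<and> D \<in> H)"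
    and "X \<in> line_through A D \<inter> line_through P Q"
    and "Y \<in> line_through B C \<inter> line_through P Q"
  shows "M = midpoint X Y"
proof -
  define u a b c d z where defs: "u = P - M" "a = A - M" "b = B - M" "c = C - M" "d = D - M" "z = Z - M"
  define p where "p = r\<^sup>2 - z \<bullet> z"
  have Q: "Q - M = - u"
    using assms(8) by (simp add: defs midpoint_def vec_eq_iff field_simps)
  have on: "(V - M) \<bullet> (V - M) - 2 * ((V - M) \<bullet> z) = p" if "V \<in> sphere Z r" for V
    unfolding p_def
    using that by (intro sphere_eq_inner) (simp add: defs dist_norm norm_minus_commute)
  have sph: "P \<in> sphere Z r" "Q \<in> sphere Z r" "A \<in> sphere Z r" "B \<in> sphere Z r"
      "C \<in> sphere Z r" "D \<in> sphere Z r" and "P \<noteq> Q"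
    using assms(2-4) by (auto simp: is_chord_def)
  have "u \<noteq> 0"
    using Q \<open>P \<noteq> Q\<close> by (auto simp: defs)
  have eqs: "a \<bullet> a - 2 * (a \<bullet> z) = p" "b \<bullet> b - 2 * (b \<bullet> z) = p"
      "c \<bullet> c - 2 * (c \<bullet> z) = p" "d \<bullet> d - 2 * (d \<bullet> z) = p"
    using on sph by (simp_all add: defs(2-5))
  have "u \<bullet> u - 2 * (u \<bullet> z) = p" "u \<bullet> u + 2 * (u \<bullet> z) = p"
    using on[OF sph(1)] on[OF sph(2)] by (simp_all add: Q flip: defs(1))
  then have "u \<bullet> z = 0" and p: "p = u \<bullet> u"
    by auto
  have "p > 0" using \<open>u \<noteq> 0\<close> by (simp add: p)
  have "0 \<in> closed_segment a b" "0 \<in> closed_segment d c"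
    using assms(9,10) closed_segment_translation_eq[of "- M" M]
    by (auto simp: defs closed_segment_commute)
  then obtain \<beta> \<gamma> where b: "b = - \<beta> *\<^sub>R a" and c: "c = - \<gamma> *\<^sub>R d"
    and \<beta>: "\<beta> * (a \<bullet> a) = p" and \<gamma>: "\<gamma> * (d \<bullet> d) = p"
    using opposite_end_of_chord[OF eqs(1,2) \<open>p > 0\<close>] opposite_end_of_chord[OF eqs(4,3) \<open>p > 0\<close>]
    by metis
  \<comment> \<open>If \<open>A\<close> were on the line \<open>PQ\<close>, it would be \<open>P\<close> or \<open>Q\<close>, and \<open>AB\<close> would be the chord \<open>PQ\<close>.\<close>
  have off: "a \<notin> range (\<lambda>k. k *\<^sub>R u)"
  proof
    assume "a \<in> range (\<lambda>k. k *\<^sub>R u)"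
    then obtain k where k: "a = k *\<^sub>R u" by auto
    have "k * k * p = p"
      using eqs(1) \<open>u \<bullet> z = 0\<close> by (simp add: k p)
    then have "k * k = 1" using \<open>p > 0\<close> by simp
    then have a: "a = u \<or> a = - u"
      using k by (auto simp: square_eq_1_iff)
    then have "a \<bullet> a = p" by (auto simp: p)
    then have "b = - a" using \<beta> \<open>p > 0\<close> by (simp add: b)
    with a have "A - M = P - M \<and> B - M = Q - M \<or> A - M = Q - M \<and> B - M = P - M"
      unfolding Q by (auto simp flip: defs)
    then have "A = P \<and> B = Q \<or> A = Q \<and> B = P"
      by simp
    then show False
      using assms(5) by (auto simp: closed_segment_commute)
  qed
  have lines: "\<exists>t. V - M = (1 - t) *\<^sub>R (E - M) + t *\<^sub>R (F - M)" if V: "V \<in> line_through E F" for V E F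
  proof -
    obtain g h where "g + h = 1" "V = g *\<^sub>R E + h *\<^sub>R F"
      using V unfolding affine_hull_2 by blast
    then have "g = 1 - h" "V = (1 - h) *\<^sub>R E + h *\<^sub>R F" by auto
    then show ?thesis by (intro exI[of _ h]) (simp add: algebra_simps)
  qed
  have axis: "\<exists>x. V - M = x *\<^sub>R u" if V: "V \<in> line_through P Q" for V
  proof -
    obtain t where "V - M = (1 - t) *\<^sub>R u + t *\<^sub>R (- u)"
      using lines[OF V] Q by (auto simp: defs(1))
    also have "\<dots> = (1 - 2 * t) *\<^sub>R u" by (simp add: algebra_simps flip: scaleR_2)
    finally show ?thesis by blast
  qed
  obtain t x where X: "X - M = (1 - t) *\<^sub>R a + t *\<^sub>R d" "X - M = x *\<^sub>R u"
    using lines[of X A D] axis[of X] assms(12) by (auto simp: defs)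
  obtain s y where Y: "Y - M = (1 - s) *\<^sub>R b + s *\<^sub>R c" "Y - M = y *\<^sub>R u"
    using lines[of Y B C] axis[of Y] assms(13) by (auto simp: defs)
  have "x + y = 0"
  proof (rule butterfly_about_origin[OF eqs(1,4) \<open>u \<bullet> z = 0\<close> _ \<beta> \<gamma> _ _ \<open>u \<noteq> 0\<close> off])
    show "p \<noteq> 0" using \<open>p > 0\<close> by simp
    show "(1 - t) *\<^sub>R a + t *\<^sub>R d = x *\<^sub>R u" using X by simp
    show "(1 - s) *\<^sub>R (- \<beta> *\<^sub>R a) + s *\<^sub>R (- \<gamma> *\<^sub>R d) = y *\<^sub>R u"
      using Y by (simp add: b c)
  qed
  then have "(X - M) + (Y - M) = 0"
    unfolding X(2) Y(2) by (simp flip: scaleR_left_distrib)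
  then have "X + Y = 2 *\<^sub>R M"
    by (simp add: scaleR_2 algebra_simps)
  then show ?thesis by (simp add: midpoint_def)
qed

end
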